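(* Let $V$ be a finite-dimensional complex vector space and let $A_1^1 = V\otimes V^{*}=\mathrm{End}(V)$. Let $\alpha,\beta,\gamma,\delta\in\mathbb{C}$ satisfy $\alpha+\beta=0$ and $\gamma+\delta=0$, and let $\varphi_2: A_1^1\times A_1^1\to A_1^1$ be the bilinear operation $$\varphi_2(A,B)=\alpha\, AB+\beta\, BA+\gamma\, \mathrm{Tr}(B)\,A+\delta\, \mathrm{Tr}(A)\,B .$$ Define $$\varphi_3(A_1,A_2,A_3)=\varphi_2(\varphi_2(A_2,A_3),A_1)-\varphi_2(\varphi_2(A_1,A_3),A_2)+\varphi_2(\varphi_2(A_1,A_2),A_3)$$ and $$\varphi_4(A_1,A_2,A_3,A_4)=\varphi_2(\varphi_3(A_2,A_3,A_4),A_1)-\varphi_2(\varphi_3(A_1,A_3,A_4),A_2)+\varphi_2(\varphi_3(A_1,A_2,A_4),A_3)-\varphi_2(\varphi_3(A_1,A_2,A_3),A_4).$$ Then $\varphi_4(A_1,A_2,A_3,A_4)=0$ for all $A_1,A_2,A_3,A_4\in A_1^1$.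
   Context: Here $AB$ denotes the usual composition (matrix product) of endomorphisms of $V$ and $\mathrm{Tr}$ the usual trace. *)

theory Defs
  imports Complex_Main
begin

text \<open>
  The library has a trace only for matrices over finite index types, so the trace of an
  endomorphism is introduced here as the sum of the diagonal entries of its matrix
  with respect to some basis; by \<open>endo_trace_eq\<close> below, every finite basis gives the same value.
\<close>

definition endo_trace :: "('k::field \<Rightarrow> 'v::ab_group_add \<Rightarrow> 'v) \<Rightarrow> ('v \<Rightarrow> 'v) \<Rightarrow> 'k" where
  "endo_trace scale f =
     (let B = (SOME B. \<not> module.dependent scale B \<and> module.span scale B = UNIV)
      in \<Sum>b\<in>B. module.representation scale B (f b) b)"

context vector_space
begin

lemma sum_representation_basis_indep:
  assumes f: "Vector_Spaces.linear scale scale f"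
    and B: "finite B" "independent B" "span B = UNIV"
    and C: "finite C" "independent C" "span C = UNIV"
  shows "(\<Sum>b\<in>B. representation B (f b) b) = (\<Sum>c\<in>C. representation C (f c) c)"
proof -
  interpret f: Vector_Spaces.linear scale scale f by (fact f)
  have expB: "(\<Sum>b\<in>B. representation B v b *s b) = v" for v
    using sum_representation_eq[OF B(2) _ B(1) order_refl] B(3) by simp
  have expC: "(\<Sum>c\<in>C. representation C v c *s c) = v" for v
    using sum_representation_eq[OF C(2) _ C(1) order_refl] C(3) by simp
  have 1: "representation B (f b) b = (\<Sum>c\<in>C. representation C (f b) c * representation B c b)" for b
  proof -
    have "representation B (f b) b = representation B (\<Sum>c\<in>C. representation C (f b) c *s c) b"
      by (simp add: expC)
    also have "\<dots> = (\<Sum>c\<in>C. representation C (f b) c * representation B c b)"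
      using B by (simp add: representation_sum representation_scale)
    finally show ?thesis .
  qed
  have 2: "representation C (f c) c = (\<Sum>b\<in>B. representation B c b * representation C (f b) c)" for c
  proof -
    have "f c = (\<Sum>b\<in>B. representation B c b *s f b)"
      using expB[of c] by (metis (mono_tags, lifting) f.scale f.sum sum.cong)
    then have "representation C (f c) c = representation C (\<Sum>b\<in>B. representation B c b *s f b) c"
      by simp
    also have "\<dots> = (\<Sum>b\<in>B. representation B c b * representation C (f b) c)"
      using C by (simp add: representation_sum representation_scale)
    finally show ?thesis .
  qed
  show ?thesis
    unfolding 1 2 by (subst sum.swap) (simp add: mult.commute)
qed

lemma endo_trace_eq:
  assumes f: "Vector_Spaces.linear scale scale f"
    and B: "finite B" "independent B" "span B = UNIV"
  shows "endo_trace scale f = (\<Sum>b\<in>B. representation B (f b) b)"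
proof -
  define C where "C = (SOME C. independent C \<and> span C = UNIV)"
  have C: "independent C \<and> span C = UNIV"
    unfolding C_def by (rule someI[of _ B]) (use B in auto)
  have "finite C"
    using independent_span_bound[OF B(1), of C] C B(3) by simp
  then show ?thesis
    using sum_representation_basis_indep[OF f B, of C] C
    by (simp add: endo_trace_def Let_def flip: C_def)
qed

end

definition phi2 ::
  "(complex \<Rightarrow> 'v::ab_group_add \<Rightarrow> 'v) \<Rightarrow> complex \<Rightarrow> complex \<Rightarrow> complex \<Rightarrow> complex
    \<Rightarrow> ('v \<Rightarrow> 'v) \<Rightarrow> ('v \<Rightarrow> 'v) \<Rightarrow> ('v \<Rightarrow> 'v)" where
  "phi2 scale \<alpha> \<beta> \<gamma> \<delta> A B =
     (\<lambda>v. scale \<alpha> ((A \<circ> B) v) + scale \<beta> ((B \<circ> A) v)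
         + scale (\<gamma> * endo_trace scale B) (A v) + scale (\<delta> * endo_trace scale A) (B v))"

definition phi3 ::
  "(complex \<Rightarrow> 'v::ab_group_add \<Rightarrow> 'v) \<Rightarrow> complex \<Rightarrow> complex \<Rightarrow> complex \<Rightarrow> complex
    \<Rightarrow> ('v \<Rightarrow> 'v) \<Rightarrow> ('v \<Rightarrow> 'v) \<Rightarrow> ('v \<Rightarrow> 'v) \<Rightarrow> ('v \<Rightarrow> 'v)" where
  "phi3 scale \<alpha> \<beta> \<gamma> \<delta> A1 A2 A3 =
     (\<lambda>v. phi2 scale \<alpha> \<beta> \<gamma> \<delta> (phi2 scale \<alpha> \<beta> \<gamma> \<delta> A2 A3) A1 v
         - phi2 scale \<alpha> \<beta> \<gamma> \<delta> (phi2 scale \<alpha> \<beta> \<gamma> \<delta> A1 A3) A2 v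
         + phi2 scale \<alpha> \<beta> \<gamma> \<delta> (phi2 scale \<alpha> \<beta> \<gamma> \<delta> A1 A2) A3 v)"

definition phi4 ::
  "(complex \<Rightarrow> 'v::ab_group_add \<Rightarrow> 'v) \<Rightarrow> complex \<Rightarrow> complex \<Rightarrow> complex \<Rightarrow> complex
    \<Rightarrow> ('v \<Rightarrow> 'v) \<Rightarrow> ('v \<Rightarrow> 'v) \<Rightarrow> ('v \<Rightarrow> 'v) \<Rightarrow> ('v \<Rightarrow> 'v) \<Rightarrow> ('v \<Rightarrow> 'v)" where
  "phi4 scale \<alpha> \<beta> \<gamma> \<delta> A1 A2 A3 A4 =
     (\<lambda>v. phi2 scale \<alpha> \<beta> \<gamma> \<delta> (phi3 scale \<alpha> \<beta> \<gamma> \<delta> A2 A3 A4) A1 v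
         - phi2 scale \<alpha> \<beta> \<gamma> \<delta> (phi3 scale \<alpha> \<beta> \<gamma> \<delta> A1 A3 A4) A2 v
         + phi2 scale \<alpha> \<beta> \<gamma> \<delta> (phi3 scale \<alpha> \<beta> \<gamma> \<delta> A1 A2 A4) A3 v
         - phi2 scale \<alpha> \<beta> \<gamma> \<delta> (phi3 scale \<alpha> \<beta> \<gamma> \<delta> A1 A2 A3) A4 v)"

end

theory Submission
  imports Defs
begin

text \<open>
  With \<open>\<beta> = - \<alpha>\<close> and \<open>\<delta> = - \<gamma>\<close> every value of \<open>\<phi>\<^sub>2\<close> has trace zero, and the Jacobi identity
  for the commutator reduces \<open>\<phi>\<^sub>3\<close> to a combination of the terms \<open>Tr(A\<^sub>i) [A\<^sub>j, A\<^sub>k]\<close>.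
  In \<open>\<phi>\<^sub>4\<close> the double commutators with coefficient \<open>Tr(A\<^sub>i)\<close> then cancel by the Jacobi
  identity again, and the terms \<open>Tr(A\<^sub>i) Tr(A\<^sub>j) [A\<^sub>k, A\<^sub>l]\<close> cancel in pairs by antisymmetry.
\<close>

context finite_dimensional_vector_space
begin

text \<open>This trades the basis picked by \<open>SOME\<close> for the fixed \<open>Basis\<close>,
  so that traces can be compared term by term.\<close>

lemma endo_trace_Basis:
  "Vector_Spaces.linear scale scale f \<Longrightarrow>
    endo_trace scale f = (\<Sum>b\<in>Basis. representation Basis (f b) b)"
  by (rule endo_trace_eq) (simp_all add: finite_Basis independent_Basis span_Basis)

lemma endo_trace_add:
  assumes f: "Vector_Spaces.linear scale scale f" and g: "Vector_Spaces.linear scale scale g"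
  shows "endo_trace scale (\<lambda>v. f v + g v) = endo_trace scale f + endo_trace scale g"
proof -
  interpret vector_space_pair scale scale ..
  show ?thesis
    using assms linear_compose_add[OF f g]
    by (simp add: endo_trace_Basis representation_add independent_Basis span_Basis sum.distrib)
qed

lemma endo_trace_scale:
  assumes f: "Vector_Spaces.linear scale scale f"
  shows "endo_trace scale (\<lambda>v. c *s f v) = c * endo_trace scale f"
proof -
  interpret vector_space_pair scale scale ..
  show ?thesis
    using f linear_compose_scale_right[OF f]
    by (simp add: endo_trace_Basis representation_scale independent_Basis span_Basis sum_distrib_left)
qed

text \<open>In matrix entries each side is a double sum over pairs of basis vectors; exchanging the
  two sums carries one into the other.\<close>

lemma endo_trace_comp_commute:
  assumes f: "Vector_Spaces.linear scale scale f" and g: "Vector_Spaces.linear scale scale g"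
  shows "endo_trace scale (f \<circ> g) = endo_trace scale (g \<circ> f)"
proof -
  have comp: "endo_trace scale (h \<circ> k) =
      (\<Sum>b\<in>Basis. \<Sum>c\<in>Basis. representation Basis (k b) c * representation Basis (h c) b)"
    if h: "Vector_Spaces.linear scale scale h" and k: "Vector_Spaces.linear scale scale k" for h k
  proof -
    interpret h: Vector_Spaces.linear scale scale h by (fact h)
    have "representation Basis (h (k b)) b =
        (\<Sum>c\<in>Basis. representation Basis (k b) c * representation Basis (h c) b)" for b
    proof -
      have "k b = (\<Sum>c\<in>Basis. representation Basis (k b) c *s c)"
        using sum_representation_eq[OF independent_Basis _ finite_Basis order_refl]
        by (simp add: span_Basis)
      then have "h (k b) = (\<Sum>c\<in>Basis. representation Basis (k b) c *s h c)"
        by (metis (mono_tags, lifting) h.scale h.sum sum.cong)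
      then show ?thesis
        by (simp add: representation_sum representation_scale independent_Basis span_Basis)
    qed
    then show ?thesis
      by (simp add: endo_trace_Basis Vector_Spaces.linear_compose[OF k h])
  qed
  show ?thesis
    unfolding comp[OF f g] comp[OF g f] by (subst sum.swap) (simp add: mult.commute)
qed

end

lemma linear_phi2:
  assumes "vector_space scale"
    and A: "Vector_Spaces.linear scale scale A" and B: "Vector_Spaces.linear scale scale B"
  shows "Vector_Spaces.linear scale scale (phi2 scale \<alpha> \<beta> \<gamma> \<delta> A B)"
proof -
  interpret vector_space scale by fact
  interpret vector_space_pair scale scale ..
  show ?thesis
    unfolding phi2_def
    by (intro linear_compose_add linear_compose_scale_right A B
        Vector_Spaces.linear_compose[OF A B] Vector_Spaces.linear_compose[OF B A])
qed

text \<open>Since Tr(BA) = Tr(AB), the \<alpha> and \<beta> terms merge, as do the two products of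
  traces; both coefficients vanish under the hypotheses of \<open>proposition1\<close>.\<close>

lemma endo_trace_phi2:
  assumes "finite_dimensional_vector_space scale Basis"
    and A: "Vector_Spaces.linear scale scale A" and B: "Vector_Spaces.linear scale scale B"
  shows "endo_trace scale (phi2 scale \<alpha> \<beta> \<gamma> \<delta> A B) =
    (\<alpha> + \<beta>) * endo_trace scale (A \<circ> B) + (\<gamma> + \<delta>) * (endo_trace scale A * endo_trace scale B)"
proof -
  interpret finite_dimensional_vector_space scale Basis by fact
  interpret vector_space_pair scale scale ..
  note lin = linear_compose_add linear_compose_scale_right A B
    Vector_Spaces.linear_compose[OF A B] Vector_Spaces.linear_compose[OF B A]
  show ?thesis
    unfolding phi2_def
    by (simp only: lin endo_trace_add endo_trace_scale)
      (simp only: endo_trace_comp_commute[OF B A], simp add: comp_def algebra_simps)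
qed

text \<open>The \<alpha>^2 terms form a Jacobi sum of double commutators, and the \<gamma>^2 terms
  cancel in pairs. Among the mixed terms each Tr(X) [Y, Z] arises three times, with signs that leave
  a single copy.\<close>

lemma phi3_eq:
  assumes "finite_dimensional_vector_space scale Basis"
    and A: "Vector_Spaces.linear scale scale A" and B: "Vector_Spaces.linear scale scale B"
    and C: "Vector_Spaces.linear scale scale C"
  shows "phi3 scale \<alpha> (- \<alpha>) \<gamma> (- \<gamma>) A B C =
    (\<lambda>v. scale (- (\<alpha> * \<gamma>))
      (scale (endo_trace scale A) (B (C v) - C (B v)) - scale (endo_trace scale B) (A (C v) - C (A v))
        + scale (endo_trace scale C) (A (B v) - B (A v))))"
proof -
  interpret finite_dimensional_vector_space scale Basis by fact
  interpret A: Vector_Spaces.linear scale scale A by fact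
  interpret B: Vector_Spaces.linear scale scale B by fact
  interpret C: Vector_Spaces.linear scale scale C by fact
  have tr: "endo_trace scale (phi2 scale \<alpha> (- \<alpha>) \<gamma> (- \<gamma>) X Y) = 0"
    if "Vector_Spaces.linear scale scale X" "Vector_Spaces.linear scale scale Y" for X Y
    using endo_trace_phi2[OF assms(1) that] by simp
  show ?thesis
    \<comment> \<open>Only the outer \<open>phi2\<close> is opened here, so that \<open>tr\<close>
      can still recognise the trace of the inner one and replace it by 0.\<close>
    unfolding phi3_def phi2_def[of _ _ _ _ _ "phi2 _ _ _ _ _ _ _"]
    by (simp only: tr A B C, rule ext)
      (simp add: phi2_def A.add A.diff A.scale A.neg B.add B.diff B.scale B.neg
        C.add C.diff C.scale C.neg algebra_simps)
qed

text \<open>By linearity of the trace this follows from the vanishing on values of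
  \<open>phi2\<close>. It removes the terms Tr(\<open>phi3\<close>) A_i from
  \<open>phi4\<close>.\<close>

lemma endo_trace_phi3:
  assumes "finite_dimensional_vector_space scale Basis"
    and A: "Vector_Spaces.linear scale scale A" and B: "Vector_Spaces.linear scale scale B"
    and C: "Vector_Spaces.linear scale scale C"
  shows "endo_trace scale (phi3 scale \<alpha> (- \<alpha>) \<gamma> (- \<gamma>) A B C) = 0"
proof -
  interpret finite_dimensional_vector_space scale Basis by fact
  interpret vector_space_pair scale scale ..
  define P where "P = phi2 scale \<alpha> (- \<alpha>) \<gamma> (- \<gamma>)"
  have lin: "Vector_Spaces.linear scale scale (P X Y)"
    and tr: "endo_trace scale (P X Y) = 0"
    if "Vector_Spaces.linear scale scale X" "Vector_Spaces.linear scale scale Y" for X Y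
    using linear_phi2[OF vector_space_axioms that] endo_trace_phi2[OF assms(1) that]
    by (simp_all add: P_def)
  \<comment> \<open>The difference is written with the scalar -1 to fit the additivity and scaling
    rules for the trace.\<close>
  have "phi3 scale \<alpha> (- \<alpha>) \<gamma> (- \<gamma>) A B C =
      (\<lambda>v. P (P B C) A v + scale (- 1) (P (P A C) B v) + P (P A B) C v)"
    by (simp add: phi3_def P_def)
  then show ?thesis
    by (simp only: endo_trace_add endo_trace_scale linear_compose_add linear_compose_scale_right
        lin tr A B C)
      simp
qed

theorem proposition1:
  fixes scale :: "complex \<Rightarrow> 'v::ab_group_add \<Rightarrow> 'v"
    and \<alpha> \<beta> \<gamma> \<delta> :: complex
    and A1 A2 A3 A4 :: "'v \<Rightarrow> 'v"
  assumes "\<exists>Basis. finite_dimensional_vector_space scale Basis"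
    and "\<alpha> + \<beta> = 0" and "\<gamma> + \<delta> = 0"
    and "Vector_Spaces.linear scale scale A1"
    and "Vector_Spaces.linear scale scale A2"
    and "Vector_Spaces.linear scale scale A3"
    and "Vector_Spaces.linear scale scale A4"
  shows "phi4 scale \<alpha> \<beta> \<gamma> \<delta> A1 A2 A3 A4 = (\<lambda>v. 0)"
proof -
  obtain Basis where fd: "finite_dimensional_vector_space scale Basis"
    using assms(1) by blast
  interpret finite_dimensional_vector_space scale Basis by (fact fd)
  interpret A1: Vector_Spaces.linear scale scale A1 by fact
  interpret A2: Vector_Spaces.linear scale scale A2 by fact
  interpret A3: Vector_Spaces.linear scale scale A3 by fact
  interpret A4: Vector_Spaces.linear scale scale A4 by fact
  have \<beta>: "\<beta> = - \<alpha>" and \<delta>: "\<delta> = - \<gamma>"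
    using assms(2,3) by (simp_all add: eq_neg_iff_add_eq_0 add.commute)
  note lin = assms(4-7)
  show ?thesis
    unfolding \<beta> \<delta> phi4_def phi2_def
    \<comment> \<open>The order matters: the traces of \<open>phi3\<close> are set to 0 while
      \<open>phi3\<close> is still folded, and only then does the closed form replace it. Expanding
      by linearity leaves the cancellations to \<open>algebra_simps\<close>.\<close>
    by (simp only: endo_trace_phi3[OF fd] lin, simp only: phi3_eq[OF fd] lin, rule ext)
      (simp add: A1.add A1.diff A1.scale A1.neg A2.add A2.diff A2.scale A2.neg
        A3.add A3.diff A3.scale A3.neg A4.add A4.diff A4.scale A4.neg algebra_simps)
qed

end
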